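(* Let $d \geq 2$ and let $m_1 \leq m_2 \leq \dots \leq m_d$ be natural numbers. Then $$box(TCC(m_1,m_2,\dots,m_d)) \leq cub(TCC(m_1,m_2,\dots,m_d)) \leq m_1+m_2+\dots+m_{d-1}.$$
   Context: Natural numbers here are positive integers. All graphs are finite, simple and undirected. Boxicity and cubicity: a $k$-box (resp. $k$-cube) is a Cartesian product of $k$ closed intervals (resp. closed unit-length intervals) of $\mathbb{R}$. A $k$-box (resp. $k$-cube) representation of a graph $\Gamma$ is a function $f$ assigning to each vertex a $k$-box (resp. $k$-cube) such that two distinct vertices $u,v$ are adjacent if and only if $f(u)\cap f(v)\neq\emptyset$. The boxicity $box(\Gamma)$ (resp. cubicity $cub(\Gamma)$) is the smallest non-negative integer $k$ for which $\Gamma$ has a $k$-box (resp. $k$-cube) representation; complete graphs have boxicity and cubicity $0$. For positive integers $a_1,\dots,a_s$, $TCC(a_1,\dots,a_s)$ (the transitive closure of the Cartesian product of the complete graphs $K_{a_1+1},\dots,K_{a_s+1}$) is the graph whose vertices are the integer $s$-tuples $x=(x_1,\dots,x_s)$ with $0\leq x_i\leq a_i$ for all $i$, where two distinct vertices $x,y$ are adjacent if and only if either $x_i\leq y_i$ for all $i$, or $x_i\geq y_i$ for all $i$. *)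

theory Defs
  imports Complex_Main "HOL-Library.FuncSet" "Graph_Theory.Pair_Digraph"
begin

(* Finite simple undirected graphs are the pair_graph digraphs of Graph_Theory: finite, loop-free
   and symmetric, with the arc set as the adjacency relation.

   Points of \<real>^k are functions on {..<k} that are undefined outside.  For k = 0 there is exactly
   one box, the one-point set, so that the graphs of boxicity or cubicity 0 are the complete ones. *)

definition is_box :: "nat \<Rightarrow> (nat \<Rightarrow> real) set \<Rightarrow> bool" where
  "is_box k B \<longleftrightarrow> (\<exists>l u. (\<forall>i<k. l i \<le> u i) \<and> B = (\<Pi>\<^sub>E i\<in>{..<k}. {l i..u i}))"

definition is_cube :: "nat \<Rightarrow> (nat \<Rightarrow> real) set \<Rightarrow> bool" where
  "is_cube k B \<longleftrightarrow> (\<exists>l. B = (\<Pi>\<^sub>E i\<in>{..<k}. {l i..l i + 1}))"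

definition intersection_rep :: "'a pair_pre_digraph \<Rightarrow> ('a \<Rightarrow> 'b set) \<Rightarrow> bool" where
  "intersection_rep G f \<longleftrightarrow>
     (\<forall>u\<in>pverts G. \<forall>v\<in>pverts G. u \<noteq> v \<longrightarrow> ((u, v) \<in> parcs G \<longleftrightarrow> f u \<inter> f v \<noteq> {}))"

definition box_rep :: "'a pair_pre_digraph \<Rightarrow> nat \<Rightarrow> ('a \<Rightarrow> (nat \<Rightarrow> real) set) \<Rightarrow> bool" where
  "box_rep G k f \<longleftrightarrow> (\<forall>v\<in>pverts G. is_box k (f v)) \<and> intersection_rep G f"

definition cube_rep :: "'a pair_pre_digraph \<Rightarrow> nat \<Rightarrow> ('a \<Rightarrow> (nat \<Rightarrow> real) set) \<Rightarrow> bool" where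
  "cube_rep G k f \<longleftrightarrow> (\<forall>v\<in>pverts G. is_cube k (f v)) \<and> intersection_rep G f"

(* For a pair_graph the minima below are attained; see ex_cube_rep and ex_box_rep. *)

definition boxicity :: "'a pair_pre_digraph \<Rightarrow> nat" where
  "boxicity G = (LEAST k. \<exists>f. box_rep G k f)"

definition cubicity :: "'a pair_pre_digraph \<Rightarrow> nat" where
  "cubicity G = (LEAST k. \<exists>f. cube_rep G k f)"

(* The s-tuples are indexed by {1..s}; only a 1, ..., a s matter. *)

definition TCC_verts :: "nat \<Rightarrow> (nat \<Rightarrow> nat) \<Rightarrow> (nat \<Rightarrow> nat) set" where
  "TCC_verts s a = (\<Pi>\<^sub>E i\<in>{1..s}. {0..a i})"

definition TCC :: "nat \<Rightarrow> (nat \<Rightarrow> nat) \<Rightarrow> (nat \<Rightarrow> nat) pair_pre_digraph" where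
  "TCC s a = \<lparr> pverts = TCC_verts s a,
     parcs = {(x, y). x \<in> TCC_verts s a \<and> y \<in> TCC_verts s a \<and> x \<noteq> y \<and>
       ((\<forall>i\<in>{1..s}. x i \<le> y i) \<or> (\<forall>i\<in>{1..s}. y i \<le> x i))} \<rparr>"

lemma pair_graph_TCC: "pair_graph (TCC s a)"
proof -
  have fin: "finite (TCC_verts s a)"
    unfolding TCC_verts_def by (intro finite_PiE) auto
  have "finite (parcs (TCC s a))"
    by (rule finite_subset[of _ "TCC_verts s a \<times> TCC_verts s a"]) (auto simp: TCC_def fin)
  with fin show ?thesis
    by unfold_locales (auto simp: TCC_def symmetric_def sym_def)
qed

lemma is_cube_imp_is_box: "is_cube k B \<Longrightarrow> is_box k B"
  unfolding is_cube_def is_box_def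
proof (elim exE)
  fix l assume "B = (\<Pi>\<^sub>E i\<in>{..<k}. {l i..l i + 1})"
  then show "\<exists>l u. (\<forall>i<k. l i \<le> u i) \<and> B = (\<Pi>\<^sub>E i\<in>{..<k}. {l i..u i})"
    by (intro exI[of _ l] exI[of _ "\<lambda>i. l i + 1"]) simp
qed

lemma cube_rep_imp_box_rep: "cube_rep G k f \<Longrightarrow> box_rep G k f"
  by (simp add: cube_rep_def box_rep_def is_cube_imp_is_box)

lemma ex_cube_rep:
  assumes "pair_graph G"
  shows "\<exists>k f. cube_rep G k f"
proof -
  interpret pair_graph G by fact
  define N where "N = {(u, v) \<in> pverts G \<times> pverts G. u \<noteq> v \<and> (u, v) \<notin> parcs G}"
  have "N \<subseteq> pverts G \<times> pverts G" by (auto simp: N_def)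
  then have "finite N"
    by (rule finite_subset) (simp add: pair_finite_verts)
  then obtain e :: "nat \<Rightarrow> 'a \<times> 'a" where e: "bij_betw e {..<card N} N"
    using ex_bij_betw_nat_finite[of N] by (auto simp: atLeast0LessThan)
  define l :: "'a \<Rightarrow> nat \<Rightarrow> real" where
    "l w j = (if w = fst (e j) then 0 else if w = snd (e j) then 2 else 1)" for w j
  define f where "f w = (\<Pi>\<^sub>E i\<in>{..<card N}. {l w i..l w i + 1})" for w
  have "(x, y) \<in> parcs G \<longleftrightarrow> f x \<inter> f y \<noteq> {}"
    if xy: "x \<in> pverts G" "y \<in> pverts G" "x \<noteq> y" for x y
  proof
    assume adj: "(x, y) \<in> parcs G"
    then have adj': "(y, x) \<in> parcs G" by (rule arcs_symmetric)
    define p where "p = (\<lambda>i\<in>{..<card N}. max (l x i) (l y i))"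
    have "l x i \<le> l y i + 1 \<and> l y i \<le> l x i + 1" if "i < card N" for i
    proof -
      have "e i \<in> N" using e that by (auto simp: bij_betw_def)
      then have "e i \<noteq> (x, y)" "e i \<noteq> (y, x)" using adj adj' by (auto simp: N_def)
      then show ?thesis using xy(3) by (cases "e i") (auto simp: l_def)
    qed
    then have "p \<in> f x \<inter> f y" by (auto simp: f_def p_def)
    then show "f x \<inter> f y \<noteq> {}" by blast
  next
    assume ne: "f x \<inter> f y \<noteq> {}"
    show "(x, y) \<in> parcs G"
    proof (rule ccontr)
      assume "(x, y) \<notin> parcs G"
      with xy have "(x, y) \<in> N" by (simp add: N_def)
      then obtain j where j: "j < card N" "e j = (x, y)"
        using e by (force simp: bij_betw_def)
      from ne obtain p where p: "p \<in> f x" "p \<in> f y" by blast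
      have "p j \<in> {l x j..l x j + 1}" "p j \<in> {l y j..l y j + 1}"
        using PiE_mem[OF p(1)[unfolded f_def]] PiE_mem[OF p(2)[unfolded f_def]] j(1) by auto
      with j(2) xy(3) show False by (simp add: l_def)
    qed
  qed
  then have "cube_rep G (card N) f"
    unfolding cube_rep_def intersection_rep_def is_cube_def f_def by blast
  then show ?thesis by blast
qed

lemma ex_box_rep: "pair_graph G \<Longrightarrow> \<exists>k f. box_rep G k f"
  using ex_cube_rep cube_rep_imp_box_rep by blast

end

(* Order the vertices by the base-B expansion whose most significant digit is the last coordinate; this
   is a linear extension g of the componentwise order.  Every threshold (i, j) with i < d cuts the
   vertices into those with x i < j and those with x i \<ge> j, and placing x at - g x / N in the first
   part and at 1 - g x / N in the second makes two vertices x, y of different parts far apart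
   exactly if g x > g y.  Comparable vertices are never far apart.  If x and y are incomparable, let
   k be the last coordinate in which they differ, say x k > y k.  Then g x > g y, and x i < y i for
   some i < k, so that x and y are far apart for the threshold (i, y i). *)

theory Submission
  imports Defs
begin

text \<open>The minimum defining \<open>cubicity G\<close> is attained, and a cube representation
  attaining it is also a box representation.\<close>

lemma boxicity_le_cubicity:
  assumes "pair_graph G"
  shows "boxicity G \<le> cubicity G"
proof -
  from ex_cube_rep[OF assms] have "\<exists>f. cube_rep G (cubicity G) f"
    unfolding cubicity_def by (rule LeastI_ex)
  then show ?thesis
    unfolding boxicity_def by (blast intro: Least_le cube_rep_imp_box_rep)
qed

lemma unit_cubes_meet_iff:
  fixes a b :: "nat \<Rightarrow> real"
  shows "(\<Pi>\<^sub>E i\<in>{..<k}. {a i..a i + 1}) \<inter> (\<Pi>\<^sub>E i\<in>{..<k}. {b i..b i + 1}) \<noteq> {} \<longleftrightarrow>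
    (\<forall>i<k. \<bar>a i - b i\<bar> \<le> 1)"
proof -
  have "{a i..a i + 1} \<inter> {b i..b i + 1} \<noteq> {} \<longleftrightarrow> \<bar>a i - b i\<bar> \<le> 1" for i
    by (auto simp: Int_atLeastAtMost)
  then show ?thesis
    unfolding PiE_Int PiE_eq_empty_iff by blast
qed

text \<open>Each \<open>p\<close> in \<open>P\<close> supplies one axis, on which \<open>v\<close>
  occupies the unit interval starting at \<open>h p v\<close>. Two unit intervals meet iff their
  left ends differ by at most 1.\<close>

lemma cubicity_le_card:
  fixes h :: "'p \<Rightarrow> 'a \<Rightarrow> real"
  assumes "finite P"
    and adj: "\<And>u v. \<lbrakk>u \<in> pverts G; v \<in> pverts G; u \<noteq> v\<rbrakk> \<Longrightarrow>
      (u, v) \<in> parcs G \<longleftrightarrow> (\<forall>p\<in>P. \<bar>h p u - h p v\<bar> \<le> 1)"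
  shows "cubicity G \<le> card P"
proof -
  obtain e :: "nat \<Rightarrow> 'p" where "bij_betw e {..<card P} P"
    using ex_bij_betw_nat_finite[OF \<open>finite P\<close>] by (auto simp: atLeast0LessThan)
  then have e: "P = e ` {..<card P}"
    by (simp add: bij_betw_def)
  define f where "f v = (\<Pi>\<^sub>E i\<in>{..<card P}. {h (e i) v..h (e i) v + 1})" for v
  have "f u \<inter> f v \<noteq> {} \<longleftrightarrow> (\<forall>p\<in>P. \<bar>h p u - h p v\<bar> \<le> 1)" for u v
    unfolding f_def unit_cubes_meet_iff by (subst (2) e) auto
  then have "intersection_rep G f"
    unfolding intersection_rep_def using adj by simp
  moreover have "is_cube (card P) (f v)" for v
    unfolding is_cube_def f_def by (rule exI[of _ "\<lambda>i. h (e i) v"]) (rule refl)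
  ultimately have "cube_rep G (card P) f"
    by (simp add: cube_rep_def)
  then show ?thesis
    unfolding cubicity_def by (blast intro: Least_le)
qed

lemma digit_sum_less_power:
  fixes x :: "nat \<Rightarrow> nat"
  assumes "B > 0" and "\<And>i. i \<in> {1..<k} \<Longrightarrow> x i < B"
  shows "(\<Sum>i = 1..<k. x i * B ^ i) < B ^ k"
  using assms(2)
proof (induction k)
  case (Suc k)
  show ?case
  \<comment> \<open>Digits are numbered from 1, so for \<open>k = 0\<close> the sum is empty and the
    claim is \<open>0 < B\<close>.\<close>
  proof (cases "k = 0")
    case False
    have "(\<Sum>i = 1..<Suc k. x i * B ^ i) = (\<Sum>i = 1..<k. x i * B ^ i) + x k * B ^ k"
      using False by simp
    also have "\<dots> < B ^ k + x k * B ^ k"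
      using Suc by simp
    also have "\<dots> = Suc (x k) * B ^ k"
      by simp
    also have "\<dots> \<le> B * B ^ k"
      using Suc.prems[of k] False by (intro mult_right_mono) auto
    finally show ?thesis by simp
  qed (use assms(1) in simp)
qed simp

text \<open>The digits of \<open>y\<close> below \<open>k\<close> amount to less than
  \<open>B ^ k\<close>, which the surplus of \<open>x\<close> in digit \<open>k\<close> already
  covers; above \<open>k\<close> both sums agree.\<close>

lemma digit_sum_less:
  fixes x y :: "nat \<Rightarrow> nat"
  assumes "B > 0" and "k \<in> {1..d}" and "y k < x k"
    and digit: "\<And>i. i \<in> {1..<k} \<Longrightarrow> y i < B"
    and eq: "\<And>i. i \<in> {k<..d} \<Longrightarrow> x i = y i"
  shows "(\<Sum>i = 1..d. y i * B ^ i) < (\<Sum>i = 1..d. x i * B ^ i)"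
proof -
  have split: "(\<Sum>i = 1..d. z i * B ^ i) =
      (\<Sum>i = 1..<k. z i * B ^ i) + z k * B ^ k + (\<Sum>i\<in>{k<..d}. z i * B ^ i)" for z :: "nat \<Rightarrow> nat"
  proof -
    have "{1..d} = insert k {1..<k} \<union> {k<..d}"
      using \<open>k \<in> {1..d}\<close> by auto
    then show ?thesis
      by (simp add: sum.union_disjoint disjoint_iff)
  qed
  have "(\<Sum>i = 1..<k. y i * B ^ i) + y k * B ^ k < Suc (y k) * B ^ k"
    using digit_sum_less_power[OF \<open>B > 0\<close> digit] by simp
  also have "\<dots> \<le> x k * B ^ k"
    using \<open>y k < x k\<close> by (intro mult_right_mono) auto
  finally show ?thesis
    unfolding split[of x] split[of y] using eq by simp
qed

definition threshold_pos :: "('a \<Rightarrow> nat) \<Rightarrow> nat \<Rightarrow> ('a \<Rightarrow> bool) \<Rightarrow> 'a \<Rightarrow> real" where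
  "threshold_pos g N Q x = of_bool (Q x) - real (g x) / real N"

text \<open>The shifts \<open>a\<close> and \<open>b\<close> lie in [0,1), so points on the same
  side of \<open>Q\<close> are always near. If only \<open>x\<close> satisfies \<open>Q\<close>, the
  distance is \<open>1 + b - a\<close>, which is at most 1 iff \<open>b \<le> a\<close>.\<close>

lemma threshold_pos_near_iff:
  assumes "g x < N" "g y < N"
  shows "\<bar>threshold_pos g N Q x - threshold_pos g N Q y\<bar> \<le> 1 \<longleftrightarrow>
    (\<not> Q x \<and> Q y \<longrightarrow> g x \<le> g y) \<and> (Q x \<and> \<not> Q y \<longrightarrow> g y \<le> g x)"
proof -
  define a b where "a = real (g x) / real N" and "b = real (g y) / real N"
  have "0 \<le> a" "a < 1" "0 \<le> b" "b < 1"
    using assms by (auto simp: a_def b_def)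
  moreover have "g x \<le> g y \<longleftrightarrow> a \<le> b" "g y \<le> g x \<longleftrightarrow> b \<le> a"
    using assms by (auto simp: a_def b_def divide_le_cancel)
  ultimately show ?thesis
    unfolding threshold_pos_def a_def[symmetric] b_def[symmetric] by (auto simp: abs_le_iff)
qed

lemma cubicity_TCC_le: "cubicity (TCC d m) \<le> (\<Sum>i = 1..d - 1. m i)"
proof -
  define V where "V = TCC_verts d m"
  \<comment> \<open>The sum serves as a common bound for all \<open>m i\<close>, so every coordinate
    is a digit below \<open>B\<close>.\<close>
  define B where "B = Suc (\<Sum>i = 1..d. m i)"
  define g :: "(nat \<Rightarrow> nat) \<Rightarrow> nat" where "g x = (\<Sum>i = 1..d. x i * B ^ i)" for x
  \<comment> \<open>One more than the value of \<open>g\<close> at the top vertex, where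
    \<open>g\<close> is largest.\<close>
  define N where "N = Suc (\<Sum>i = 1..d. m i * B ^ i)"
  \<comment> \<open>Threshold 0 would separate nothing, so coordinate \<open>i\<close> contributes
    exactly \<open>m i\<close> thresholds.\<close>
  define P where "P = (SIGMA i:{1..d - 1}. {1..m i})"
  define h where "h p = threshold_pos g N (\<lambda>x. snd p \<le> x (fst p))" for p :: "nat \<times> nat"

  have bound: "x i \<le> m i" if "x \<in> V" "i \<in> {1..d}" for x i
    using that by (auto simp: V_def TCC_verts_def)
  have digit: "x i < B" if "x \<in> V" "i \<in> {1..d}" for x i
    using bound[OF that] member_le_sum[of i "{1..d}" m] that(2) by (simp add: B_def)
  have mono: "g x \<le> g y" if "\<forall>i\<in>{1..d}. x i \<le> y i" for x y
    unfolding g_def using that by (intro sum_mono mult_right_mono) auto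
  have g_less: "g x < N" if "x \<in> V" for x
    unfolding g_def N_def less_Suc_eq_le using bound[OF that]
    by (intro sum_mono mult_right_mono) auto

  have near: "\<bar>h p x - h p y\<bar> \<le> 1"
    if "x \<in> V" "y \<in> V" "p \<in> P" and le: "\<forall>i\<in>{1..d}. x i \<le> y i" for p x y
  proof -
    have "fst p \<in> {1..d}"
      using \<open>p \<in> P\<close> by (auto simp: P_def)
    then have "x (fst p) \<le> y (fst p)"
      using le by blast
    \<comment> \<open>Passing from \<open>x\<close> up to \<open>y\<close> can only cross the
      threshold upwards, and there \<open>g x \<le> g y\<close> keeps the two near.\<close>
    then show ?thesis
      using mono[OF le] that by (auto simp: h_def threshold_pos_near_iff g_less)
  qed

  have far: "\<exists>p\<in>P. \<bar>h p x - h p y\<bar> > 1"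
    if "x \<in> V" "y \<in> V" and k: "k \<in> {1..d}" "y k < x k" "\<And>i. i \<in> {k<..d} \<Longrightarrow> x i = y i"
      and nle: "\<not> (\<forall>i\<in>{1..d}. y i \<le> x i)" for x y k
  proof -
    have "g y < g x"
      unfolding g_def using digit[OF \<open>y \<in> V\<close>] k
      by (intro digit_sum_less[where k = k]) (auto simp: B_def)
    obtain i where i: "i \<in> {1..d}" "x i < y i"
      using nle by (auto simp: not_le)
    \<comment> \<open>At \<open>k\<close> the order is the opposite one, and beyond \<open>k\<close>
      the tuples agree. From \<open>i < k\<close> and \<open>k \<le> d\<close> follows
      \<open>i \<le> d - 1\<close>, so the last coordinate needs no thresholds;
      \<open>x i < y i\<close> makes \<open>y i\<close> positive.\<close>
    have "i < k"
      using i k by (metis greaterThanAtMost_iff atLeastAtMost_iff less_irrefl less_asym linorder_neqE_nat)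
    then have "(i, y i) \<in> P"
      using i k(1) bound[OF \<open>y \<in> V\<close> i(1)] by (auto simp: P_def)
    moreover have "\<not> \<bar>h (i, y i) x - h (i, y i) y\<bar> \<le> 1"
      using \<open>g y < g x\<close> i(2) that(1,2) by (simp add: h_def threshold_pos_near_iff g_less)
    ultimately show ?thesis
      by (meson not_le)
  qed

  have "cubicity (TCC d m) \<le> card P"
  proof (rule cubicity_le_card[where h = h])
    show "finite P"
      by (simp add: P_def)
  next
    fix x y
    assume "x \<in> pverts (TCC d m)" "y \<in> pverts (TCC d m)" "x \<noteq> y"
    then have V: "x \<in> V" "y \<in> V" and "x \<noteq> y"
      by (auto simp: TCC_def V_def)
    have adj: "(x, y) \<in> parcs (TCC d m) \<longleftrightarrow>
        (\<forall>i\<in>{1..d}. x i \<le> y i) \<or> (\<forall>i\<in>{1..d}. y i \<le> x i)"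
      using V \<open>x \<noteq> y\<close> by (simp add: TCC_def V_def)
    define D where "D = {i \<in> {1..d}. x i \<noteq> y i}"
    \<comment> \<open>Tuples are undefined outside \<open>{1..d}\<close>, so distinct ones differ at
      some index in that range.\<close>
    have "D \<noteq> {}"
      using V \<open>x \<noteq> y\<close> unfolding D_def V_def TCC_verts_def by (blast intro: PiE_ext)
    then have "Max D \<in> D"
      by (intro Max_in) (auto simp: D_def)
    then have last: "Max D \<in> {1..d}" "x (Max D) \<noteq> y (Max D)"
      by (auto simp: D_def)
    have above: "x i = y i" if "i \<in> {Max D<..d}" for i
    proof (rule ccontr)
      assume "x i \<noteq> y i"
      with that have "i \<in> D"
        by (auto simp: D_def)
      then have "i \<le> Max D"
        by (intro Max_ge) (auto simp: D_def)
      with that show False by simp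
    qed
    show "(x, y) \<in> parcs (TCC d m) \<longleftrightarrow> (\<forall>p\<in>P. \<bar>h p x - h p y\<bar> \<le> 1)"
    proof
      assume "(x, y) \<in> parcs (TCC d m)"
      then show "\<forall>p\<in>P. \<bar>h p x - h p y\<bar> \<le> 1"
        using near[of x y] near[of y x] V unfolding adj by (auto simp: abs_minus_commute)
    next
      assume all: "\<forall>p\<in>P. \<bar>h p x - h p y\<bar> \<le> 1"
      show "(x, y) \<in> parcs (TCC d m)"
      proof (rule ccontr)
        assume "(x, y) \<notin> parcs (TCC d m)"
        then have nle: "\<not> (\<forall>i\<in>{1..d}. y i \<le> x i)" "\<not> (\<forall>i\<in>{1..d}. x i \<le> y i)"
          unfolding adj by auto
        have "\<exists>p\<in>P. \<bar>h p x - h p y\<bar> > 1"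
        \<comment> \<open>Incomparability is symmetric: \<open>far\<close> applies with the larger
          last differing entry in the role of \<open>x\<close>.\<close>
        proof (cases "y (Max D) < x (Max D)")
          case True
          then show ?thesis
            using far[OF V last(1) _ above nle(1)] by blast
        next
          case False
          then have "x (Max D) < y (Max D)"
            using last(2) by simp
          then show ?thesis
            using far[OF V(2,1) last(1) _ above[symmetric] nle(2)]
            by (simp add: abs_minus_commute)
        qed
        with all show False
          by (meson not_le)
      qed
    qed
  qed
  also have "card P = (\<Sum>i = 1..d - 1. m i)"
    by (simp add: P_def)
  finally show ?thesis .
qed

theorem theorem1:
  fixes d :: nat and m :: "nat \<Rightarrow> nat"
  assumes "d \<ge> 2"
    and "\<forall>i\<in>{1..d}. m i \<ge> 1"
    and "mono_on {1..d} m"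
  shows "boxicity (TCC d m) \<le> cubicity (TCC d m) \<and> cubicity (TCC d m) \<le> (\<Sum>i = 1..d - 1. m i)"
  using boxicity_le_cubicity[OF pair_graph_TCC] cubicity_TCC_le by blast

end
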